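(* Fix a nonempty $S\subseteq[n]$ with $|S|=s$, and suppose the linear model $f(Y)=X_S^T\beta_S+\varepsilon_S$ holds, that $$\max\Big\{\sup_{\|\theta\|_2=1}\mathbb E[\langle X_S,\theta\rangle^4]^{1/4},\ \big\|\,\|X_S\|_2\,\big\|_{\psi_1}\Big\}\le K$$ for some $1\le K<\infty$, and that $\Lambda_S=\mathbb E[X_SX_S^T]$ is invertible. Let $\{B_k\}_{k=1}^\infty$ be budgets satisfying $\lim_{k\to\infty}B_k=\infty$, and let $m_k$ and $N_k$ be the respective numbers of exploration rounds and exploitation samples, satisfying $\min(m_k,N_k)\to\infty$. Let $\mathrm{LRMC}_{S,k}$ be the LRMC estimator under budget $B_k$, and $\widehat\beta_{S,k}$ the corresponding estimator for $\beta_S$. Then, for almost every sequence $\{\widehat\beta_{S,k}\}_{k=1}^\infty$, $\mathrm{LRMC}_{S,k}\to\mathbb E[f(Y)]$ in probability as $k\to\infty$ (the convergence in probability being understood conditionally on the sequence $\{\widehat\beta_{S,k}\}_{k=1}^\infty$).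
   Context: Setting. $X^{(1)},\dots,X^{(n)}$ and $f(Y)$ are real random variables on a common probability space, with sampling costs $c_1,\dots,c_n$ and $c_0$ respectively. For nonempty $S\subseteq[n]=\{1,\dots,n\}$ with $|S|=s$, $X_S=(1,(X^{(i)})_{i\in S})^T\in\mathbb R^{s+1}$. The linear model assumption is $f(Y)=X_S^T\beta_S+\varepsilon_S$ with $\beta_S\in\mathbb R^{s+1}$ a deterministic coefficient vector and $\varepsilon_S$ a centered sub-Gaussian random variable with variance $\sigma_S^2$, independent of $X_S$. For a random variable $W$ and $\alpha\ge1$, $\|W\|_{\psi_\alpha}=\inf\{C>0:\mathbb E[\exp(|W|^\alpha/C^\alpha)]\le2\}$. Exploration. Under budget $B_k$, one collects $m_k>n+1$ i.i.d. joint samples $(X^{(1)}_\ell,\dots,X^{(n)}_\ell,f(Y_\ell))$, $\ell\in[m_k]$, of $(X^{(1)},\dots,X^{(n)},f(Y))$. With $Z$ the $m_k\times(s+1)$ design matrix whose $\ell$-th row is $(1,(X^{(i)}_\ell)_{i\in S})$ (assumed to have full column rank), the least squares estimator of $\beta_S$ is $\widehat\beta_{S,k}=(Z^TZ)^{-1}Z^T(f(Y_1),\dots,f(Y_{m_k}))^T$. Exploitation. Let $c_{\mathrm{epr}}=\sum_{i=0}^nc_i$, $c_{\mathrm{ept}}(S)=\sum_{i\in S}c_i$ and $N_k=\lfloor(B_k-c_{\mathrm{epr}}m_k)/c_{\mathrm{ept}}(S)\rfloor$. With $X_{S,\ell}$, $\ell\in[N_k]$, i.i.d. samples of $X_S$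 that are independent of the samples in the exploration stage, the Linear Regression Monte-Carlo (LRMC) estimator under budget $B_k$ is $$\mathrm{LRMC}_{S,k}=\frac1{N_k}\sum_{\ell\in[N_k]}X_{S,\ell}^T\widehat\beta_{S,k}.$$ *)

theory Defs
  imports "HOL-Probability.Probability"
begin

text \<open>The expectation is a nonnegative integral and the infimum is taken in
  \<^typ>\<open>ennreal\<close>, so a variable without finite exponential moments has norm \<open>\<infinity>\<close>.\<close>

definition psi_norm :: "'a measure \<Rightarrow> real \<Rightarrow> ('a \<Rightarrow> real) \<Rightarrow> ennreal" where
  "psi_norm M \<alpha> W =
     Inf (ennreal ` {C. C > 0 \<and>
       (\<integral>\<^sup>+ \<omega>. ennreal (exp (\<bar>W \<omega>\<bar> powr \<alpha> / C powr \<alpha>)) \<partial>M) \<le> 2})"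

definition sub_gaussian :: "'a measure \<Rightarrow> ('a \<Rightarrow> real) \<Rightarrow> bool" where
  "sub_gaussian M W \<longleftrightarrow> W \<in> borel_measurable M \<and> psi_norm M 2 W < \<infinity>"

text \<open>\<^const>\<open>prob_space.indep_var\<close> requires both variables to have the same type.\<close>

definition indep_rvs ::
  "'a measure \<Rightarrow> 'b measure \<Rightarrow> ('a \<Rightarrow> 'b) \<Rightarrow> 'c measure \<Rightarrow> ('a \<Rightarrow> 'c) \<Rightarrow> bool" where
  "indep_rvs M N\<^sub>1 U N\<^sub>2 V \<longleftrightarrow>
     U \<in> measurable M N\<^sub>1 \<and> V \<in> measurable M N\<^sub>2 \<and>
     prob_space.indep_set M (sets (vimage_algebra (space M) U N\<^sub>1))
                            (sets (vimage_algebra (space M) V N\<^sub>2))"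

definition iid_copies ::
  "'a measure \<Rightarrow> 'b measure \<Rightarrow> nat set \<Rightarrow> (nat \<Rightarrow> 'a \<Rightarrow> 'b) \<Rightarrow> ('a \<Rightarrow> 'b) \<Rightarrow> bool" where
  "iid_copies M N I V V\<^sub>0 \<longleftrightarrow>
     prob_space.indep_vars M (\<lambda>_. N) V I \<and> (\<forall>l\<in>I. distr M N (V l) = distr M N V\<^sub>0)"

text \<open>A nonempty \<open>S \<subseteq> {1..n}\<close> is enumerated by a bijection \<open>e\<close> from a finite type \<open>'s\<close>, so that
  \<open>\<real>\<close>-vectors of length \<open>s + 1\<close> are elements of \<^typ>\<open>real ^ ('s option)\<close>;
  the coordinate \<^const>\<open>None\<close> is the intercept.\<close>

definition regressor :: "('s::finite \<Rightarrow> nat) \<Rightarrow> (nat \<Rightarrow> 'a \<Rightarrow> real) \<Rightarrow> 'a \<Rightarrow> real ^ ('s option)" where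
  "regressor e X \<omega> = (\<chi> j. case j of None \<Rightarrow> 1 | Some t \<Rightarrow> X (e t) \<omega>)"

definition linear_model ::
  "'a measure \<Rightarrow> ('a \<Rightarrow> real ^ 'd) \<Rightarrow> ('a \<Rightarrow> real) \<Rightarrow> real ^ 'd \<Rightarrow> ('a \<Rightarrow> real) \<Rightarrow> real \<Rightarrow> bool" where
  "linear_model M XS fY \<beta> \<epsilon> \<sigma> \<longleftrightarrow>
     (AE \<omega> in M. fY \<omega> = XS \<omega> \<bullet> \<beta> + \<epsilon> \<omega>) \<and>
     sub_gaussian M \<epsilon> \<and>
     prob_space.expectation M \<epsilon> = 0 \<and>
     prob_space.variance M \<epsilon> = \<sigma>\<^sup>2 \<and>
     indep_rvs M borel XS borel \<epsilon>"

definition second_moment_matrix :: "'a measure \<Rightarrow> ('a \<Rightarrow> real ^ 'd) \<Rightarrow> real ^ 'd ^ 'd" where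
  "second_moment_matrix M XS = (\<chi> i j. prob_space.expectation M (\<lambda>\<omega>. XS \<omega> $ i * XS \<omega> $ j))"

definition joint_space :: "nat \<Rightarrow> ((nat \<Rightarrow> real) \<times> real) measure" where
  "joint_space n = (\<Pi>\<^sub>M i\<in>{1..n}. borel) \<Otimes>\<^sub>M borel"

definition joint_vector ::
  "nat \<Rightarrow> (nat \<Rightarrow> 'a \<Rightarrow> real) \<Rightarrow> ('a \<Rightarrow> real) \<Rightarrow> 'a \<Rightarrow> (nat \<Rightarrow> real) \<times> real" where
  "joint_vector n X fY \<omega> = ((\<lambda>i\<in>{1..n}. X i \<omega>), fY \<omega>)"

text \<open>The number of rows \<open>m\<close> of a design matrix varies, so the matrix is given by its rows
  \<open>Z l\<close>, \<open>l < m\<close>; the matrices \<open>Z\<^sup>T Z\<close> and \<open>Z\<^sup>T y\<close> have fixed dimensions.\<close>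

definition full_column_rank :: "nat \<Rightarrow> (nat \<Rightarrow> real ^ 'd) \<Rightarrow> bool" where
  "full_column_rank m Z \<longleftrightarrow> (\<forall>v :: real ^ 'd. (\<forall>l<m. (\<Sum>j\<in>UNIV. v $ j * Z l $ j) = 0) \<longrightarrow> v = 0)"

definition gram :: "nat \<Rightarrow> (nat \<Rightarrow> real ^ 'd) \<Rightarrow> real ^ 'd ^ 'd" where
  "gram m Z = (\<chi> i j. \<Sum>l<m. Z l $ i * Z l $ j)"

definition transpose_mult :: "nat \<Rightarrow> (nat \<Rightarrow> real ^ 'd) \<Rightarrow> (nat \<Rightarrow> real) \<Rightarrow> real ^ 'd" where
  "transpose_mult m Z y = (\<chi> j. \<Sum>l<m. Z l $ j * y l)"

definition least_squares :: "nat \<Rightarrow> (nat \<Rightarrow> real ^ 'd) \<Rightarrow> (nat \<Rightarrow> real) \<Rightarrow> real ^ 'd" where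
  "least_squares m Z y = matrix_inv (gram m Z) *v transpose_mult m Z y"

text \<open>\<open>Xe l i\<close> and \<open>fe l\<close> are the \<open>l\<close>-th exploration samples of \<open>X i\<close> and of \<open>f(Y)\<close>.\<close>

definition beta_hat ::
  "('s::finite \<Rightarrow> nat) \<Rightarrow> (nat \<Rightarrow> nat \<Rightarrow> 'a \<Rightarrow> real) \<Rightarrow> (nat \<Rightarrow> 'a \<Rightarrow> real) \<Rightarrow> nat \<Rightarrow> 'a
    \<Rightarrow> real ^ ('s option)" where
  "beta_hat e Xe fe m \<omega> = least_squares m (\<lambda>l. regressor e (Xe l) \<omega>) (\<lambda>l. fe l \<omega>)"

definition exploitation_count :: "nat \<Rightarrow> nat set \<Rightarrow> (nat \<Rightarrow> real) \<Rightarrow> real \<Rightarrow> nat \<Rightarrow> nat" where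
  "exploitation_count n S c B m =
     nat \<lfloor>(B - (\<Sum>i=0..n. c i) * real m) / (\<Sum>i\<in>S. c i)\<rfloor>"

definition lrmc :: "nat \<Rightarrow> (nat \<Rightarrow> 'a \<Rightarrow> real ^ 'd) \<Rightarrow> ('a \<Rightarrow> real ^ 'd) \<Rightarrow> 'a \<Rightarrow> real" where
  "lrmc N T b \<omega> = (1 / real N) * (\<Sum>l<N. T l \<omega> \<bullet> b \<omega>)"

definition sequence_algebra ::
  "'a measure \<Rightarrow> (nat \<Rightarrow> 'a \<Rightarrow> 'b::topological_space) \<Rightarrow> 'a measure" where
  "sequence_algebra M b = vimage_algebra (space M) (\<lambda>\<omega> k. b k \<omega>) (\<Pi>\<^sub>M k\<in>UNIV. borel)"

text \<open>Almost surely, the conditional probabilities given \<open>F\<close> of the events \<open>\<bar>W k - a\<bar> > \<delta>\<close> tend to \<open>0\<close>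
  for all \<open>\<delta> > 0\<close>. Rational \<open>\<delta>\<close> suffice by monotonicity; conditional probabilities being determined
  only almost surely, the exceptional null set can only be shared by countably many events.
  The first two conjuncts exclude the case where \<^const>\<open>real_cond_exp\<close> takes a dummy value.\<close>

definition cond_tendsto_in_prob ::
  "'a measure \<Rightarrow> 'a measure \<Rightarrow> (nat \<Rightarrow> 'a \<Rightarrow> real) \<Rightarrow> real \<Rightarrow> bool" where
  "cond_tendsto_in_prob M F W a \<longleftrightarrow>
     subalgebra M F \<and> (\<forall>k. W k \<in> borel_measurable M) \<and>
     (AE \<omega> in M. \<forall>\<delta>\<in>\<rat>. \<delta> > 0 \<longrightarrow>
        (\<lambda>k. real_cond_exp M F (indicator {\<omega>' \<in> space M. \<bar>W k \<omega>' - a\<bar> > \<delta>}) \<omega>)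
          \<longlonglongrightarrow> 0)"

end

theory Submission
  imports Defs
begin

text \<open>
  The exponential moments make all products \<open>X\<^sub>i X\<^sub>j\<close> and \<open>X\<^sub>j f(Y)\<close> have finite fourth moments, so
  the strong law of large numbers applies to the normalised entries of \<open>Z\<^sup>T Z\<close> and \<open>Z\<^sup>T y\<close>. By Cramer's
  rule the least squares estimator is a continuous function of these entries near \<open>(\<Lambda>, \<Lambda>\<beta>)\<close>, hence it
  converges to \<open>\<beta>\<close> almost surely.

  Let \<open>\<mu> = E[X\<^sub>S]\<close>, so that \<open>E[f(Y)] = \<mu> \<bullet> \<beta>\<close>, and let \<open>T\<close> be the mean of the exploitation samples. For small
  \<open>\<eta>\<close> the event \<open>\<bar>T \<bullet> b - \<mu> \<bullet> \<beta>\<bar> > \<delta>\<close> is contained in the union of \<open>norm (b - \<beta>) > \<eta>\<close> and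
  \<open>norm (T - \<mu>) > \<eta>\<close>. Given the estimators \<open>b\<close>, the conditional probability of the first event is its
  indicator, which is eventually \<open>0\<close>; that of the second is its plain probability, by independence,
  which tends to \<open>0\<close> by the weak law.
\<close>

section \<open>Laws of large numbers under a fourth moment\<close>

lemma borel_measurable_vec_nth_iff:
  fixes f :: "'a \<Rightarrow> real ^ 'd"
  shows "f \<in> borel_measurable M \<longleftrightarrow> (\<forall>i. (\<lambda>x. f x $ i) \<in> borel_measurable M)"
  unfolding borel_measurable_euclidean_space[of f] by (auto simp: Basis_vec_def inner_axis)

lemma (in prob_space) integrable_power_le_4:
  fixes Y :: "'a \<Rightarrow> real"
  assumes [measurable]: "Y \<in> borel_measurable M" and int: "integrable M (\<lambda>\<omega>. Y \<omega> ^ 4)"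
    and "k \<le> 4"
  shows "integrable M (\<lambda>\<omega>. Y \<omega> ^ k)"
proof (rule Bochner_Integration.integrable_bound)
  show "integrable M (\<lambda>\<omega>. 1 + Y \<omega> ^ 4)"
    using int by simp
  have "\<bar>y\<bar> ^ k \<le> 1 + y ^ 4" for y :: real
  proof (cases "\<bar>y\<bar> \<le> 1")
    case True
    then have "\<bar>y\<bar> ^ k \<le> 1" by (simp add: power_le_one)
    moreover have "0 \<le> y ^ 4" by simp
    ultimately show ?thesis by linarith
  next
    case False
    then have "\<bar>y\<bar> ^ k \<le> \<bar>y\<bar> ^ 4" using \<open>k \<le> 4\<close> by (intro power_increasing) auto
    then show ?thesis by simp
  qed
  then show "AE \<omega> in M. norm (Y \<omega> ^ k) \<le> norm (1 + Y \<omega> ^ 4)"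
    by (simp add: power_abs)
qed simp

text \<open>Add the summands one at a time. In the expansion of (S + Z)^4, with Z the new summand,
  the terms Z S^3 and Z^3 S have mean 0 by independence and centering. What remains beyond E[S^4] is
  6 E[Z^2] E[S^2] + E[Z^4], which is at most linear in the number of terms, so the total grows at
  most quadratically.\<close>

lemma (in prob_space) fourth_moment_sum:
  fixes Y :: "nat \<Rightarrow> 'a \<Rightarrow> real"
  assumes indep: "indep_vars (\<lambda>_. borel) Y {..<n}"
    and int: "\<And>l. l < n \<Longrightarrow> integrable M (\<lambda>\<omega>. Y l \<omega> ^ 4)"
    and cent: "\<And>l. l < n \<Longrightarrow> expectation (Y l) = 0"
    and bound: "\<And>l. l < n \<Longrightarrow> expectation (\<lambda>\<omega>. Y l \<omega> ^ 4) \<le> C"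
    and C: "1 \<le> C"
  shows "integrable M (\<lambda>\<omega>. (\<Sum>l<n. Y l \<omega>) ^ 4)"
    and "expectation (\<lambda>\<omega>. (\<Sum>l<n. Y l \<omega>) ^ 4) \<le> 4 * C\<^sup>2 * (real n)\<^sup>2"
proof -
  have meas: "Y l \<in> borel_measurable M" if "l < n" for l
    using indep that by (simp add: indep_vars_def)
  \<comment> \<open>The induction also carries the mean and the second moment of the partial sum,
    which the expansion of the fourth power calls for.\<close>
  have main: "integrable M (\<lambda>\<omega>. (\<Sum>l<p. Y l \<omega>) ^ 4) \<and> expectation (\<lambda>\<omega>. \<Sum>l<p. Y l \<omega>) = 0
      \<and> expectation (\<lambda>\<omega>. (\<Sum>l<p. Y l \<omega>)\<^sup>2) \<le> C * real p
      \<and> expectation (\<lambda>\<omega>. (\<Sum>l<p. Y l \<omega>) ^ 4) \<le> 4 * C\<^sup>2 * (real p)\<^sup>2" if "p \<le> n" for p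
    using that
  proof (induction p)
    case 0
    show ?case by simp
  next
    case (Suc p)
    define S where "S = (\<lambda>\<omega>. \<Sum>l<p. Y l \<omega>)"
    define Z where "Z = Y p"
    have p: "p < n" using Suc.prems by simp
    have IH: "integrable M (\<lambda>\<omega>. S \<omega> ^ 4)" "expectation S = 0"
      "expectation (\<lambda>\<omega>. (S \<omega>)\<^sup>2) \<le> C * real p"
      "expectation (\<lambda>\<omega>. S \<omega> ^ 4) \<le> 4 * C\<^sup>2 * (real p)\<^sup>2"
      using Suc.IH p by (simp_all add: S_def)
    have Zm [measurable]: "Z \<in> borel_measurable M" using meas[OF p] by (simp add: Z_def)
    have Sm [measurable]: "S \<in> borel_measurable M"
      unfolding S_def using meas p by (intro borel_measurable_sum) auto
    have indZS: "indep_var borel Z borel S"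
      unfolding Z_def S_def
      by (intro indep_vars_sum indep_vars_subset[OF indep]) (use p in auto)
    have Zi: "integrable M (\<lambda>\<omega>. Z \<omega> ^ i)" if "i \<le> 4" for i
      using integrable_power_le_4[OF Zm] int[OF p] that by (simp add: Z_def)
    have Si: "integrable M (\<lambda>\<omega>. S \<omega> ^ i)" if "i \<le> 4" for i
      using integrable_power_le_4[OF Sm IH(1)] that by simp
    have indp: "indep_var borel (\<lambda>\<omega>. Z \<omega> ^ i) borel (\<lambda>\<omega>. S \<omega> ^ j)" for i j
      using indep_var_compose[OF indZS, of "\<lambda>x. x ^ i" borel "\<lambda>x. x ^ j" borel] by (simp add: o_def)
    have prodi: "integrable M (\<lambda>\<omega>. Z \<omega> ^ i * S \<omega> ^ j)" if "i \<le> 4" "j \<le> 4" for i j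
      using indep_var_integrable[OF indp Zi Si] that by simp
    have prode: "expectation (\<lambda>\<omega>. Z \<omega> ^ i * S \<omega> ^ j)
        = expectation (\<lambda>\<omega>. Z \<omega> ^ i) * expectation (\<lambda>\<omega>. S \<omega> ^ j)" if "i \<le> 4" "j \<le> 4" for i j
      using indep_var_lebesgue_integral[OF indp Zi Si] that by simp
    have Z0: "expectation Z = 0" and Z4: "expectation (\<lambda>\<omega>. Z \<omega> ^ 4) \<le> C"
      using cent[OF p] bound[OF p] by (simp_all add: Z_def)
    \<comment> \<open>Expanding (z^2 - 1)^2 \<ge> 0 bounds the second moment by (1 + C) / 2, and
      this is at most C since C \<ge> 1.\<close>
    have Z2: "expectation (\<lambda>\<omega>. (Z \<omega>)\<^sup>2) \<le> C"
    proof -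
      have "z\<^sup>2 \<le> (1 + z ^ 4) / 2" for z :: real
        using zero_le_power2[of "z\<^sup>2 - 1"] by (simp add: power2_diff flip: power_mult)
      then have "expectation (\<lambda>\<omega>. (Z \<omega>)\<^sup>2) \<le> expectation (\<lambda>\<omega>. (1 + Z \<omega> ^ 4) / 2)"
        using Zi[of 2] Zi[of 4] by (intro integral_mono) auto
      also have "\<dots> = (1 + expectation (\<lambda>\<omega>. Z \<omega> ^ 4)) / 2"
        using Zi[of 4] by (simp add: prob_space)
      also have "\<dots> \<le> C" using Z4 C by simp
      finally show ?thesis .
    qed
    \<comment> \<open>Exponents 1 are written out so that every mixed term is an instance of
      \<open>prodi\<close> and \<open>prode\<close>.\<close>
    have e4: "(S \<omega> + Z \<omega>) ^ 4 = S \<omega> ^ 4 + 4 * (Z \<omega> ^ 1 * S \<omega> ^ 3) + 6 * (Z \<omega> ^ 2 * S \<omega> ^ 2)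
        + 4 * (Z \<omega> ^ 3 * S \<omega> ^ 1) + Z \<omega> ^ 4" for \<omega>
      by (simp add: power4_eq_xxxx power3_eq_cube power2_eq_square algebra_simps)
    have e2: "(S \<omega> + Z \<omega>)\<^sup>2 = S \<omega> ^ 2 + 2 * (Z \<omega> ^ 1 * S \<omega> ^ 1) + Z \<omega> ^ 2" for \<omega>
      by (simp add: power2_eq_square algebra_simps)
    note ints = prodi[of 1 3] prodi[of 2 2] prodi[of 3 1] prodi[of 1 1] Si[of 1] Si[of 2] Si[of 4]
      Zi[of 1] Zi[of 2] Zi[of 4]
    have i4: "integrable M (\<lambda>\<omega>. (S \<omega> + Z \<omega>) ^ 4)"
      unfolding e4 using ints by (intro Bochner_Integration.integrable_add integrable_mult_right) auto
    have m1: "expectation (\<lambda>\<omega>. S \<omega> + Z \<omega>) = 0"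
      using ints IH(2) Z0 by simp
    have m2: "expectation (\<lambda>\<omega>. (S \<omega> + Z \<omega>)\<^sup>2) = expectation (\<lambda>\<omega>. (S \<omega>)\<^sup>2) + expectation (\<lambda>\<omega>. (Z \<omega>)\<^sup>2)"
    proof -
      have "expectation (\<lambda>\<omega>. (S \<omega> + Z \<omega>)\<^sup>2)
          = expectation (\<lambda>\<omega>. S \<omega> ^ 2) + 2 * expectation (\<lambda>\<omega>. Z \<omega> ^ 1 * S \<omega> ^ 1)
            + expectation (\<lambda>\<omega>. Z \<omega> ^ 2)"
        unfolding e2 using ints by (simp del: power_one_right One_nat_def)
      then show ?thesis using prode[of 1 1] IH(2) by simp
    qed
    have m4: "expectation (\<lambda>\<omega>. (S \<omega> + Z \<omega>) ^ 4) = expectation (\<lambda>\<omega>. S \<omega> ^ 4)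
        + 6 * (expectation (\<lambda>\<omega>. (Z \<omega>)\<^sup>2) * expectation (\<lambda>\<omega>. (S \<omega>)\<^sup>2)) + expectation (\<lambda>\<omega>. Z \<omega> ^ 4)"
    proof -
      have "expectation (\<lambda>\<omega>. (S \<omega> + Z \<omega>) ^ 4)
          = expectation (\<lambda>\<omega>. S \<omega> ^ 4) + 4 * expectation (\<lambda>\<omega>. Z \<omega> ^ 1 * S \<omega> ^ 3)
            + 6 * expectation (\<lambda>\<omega>. Z \<omega> ^ 2 * S \<omega> ^ 2) + 4 * expectation (\<lambda>\<omega>. Z \<omega> ^ 3 * S \<omega> ^ 1)
            + expectation (\<lambda>\<omega>. Z \<omega> ^ 4)"
        unfolding e4 using ints by (simp del: power_one_right One_nat_def)
      then show ?thesis using prode[of 1 3] prode[of 3 1] prode[of 2 2] IH(2) Z0 by simp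
    qed
    have "expectation (\<lambda>\<omega>. (Z \<omega>)\<^sup>2) * expectation (\<lambda>\<omega>. (S \<omega>)\<^sup>2) \<le> C\<^sup>2 * real p"
      using mult_mono[OF Z2 IH(3)] C by (simp add: power2_eq_square mult.assoc)
    moreover have "C \<le> C\<^sup>2" using C by (simp add: power2_eq_square)
    moreover have "0 \<le> C\<^sup>2 * real p" by simp
    \<comment> \<open>The new terms contribute at most 6 C^2 p + C; the coefficients 8 and 4 are the
      ones that complete the square 4 C^2 (p + 1)^2.\<close>
    ultimately have "expectation (\<lambda>\<omega>. (S \<omega> + Z \<omega>) ^ 4)
        \<le> 4 * C\<^sup>2 * (real p)\<^sup>2 + 8 * (C\<^sup>2 * real p) + 4 * C\<^sup>2"
      using m4 IH(4) Z4 C by linarith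
    also have "\<dots> = 4 * C\<^sup>2 * (real (Suc p))\<^sup>2"
      by (simp add: power2_eq_square algebra_simps)
    finally have b4: "expectation (\<lambda>\<omega>. (S \<omega> + Z \<omega>) ^ 4) \<le> 4 * C\<^sup>2 * (real (Suc p))\<^sup>2" .
    have b2: "expectation (\<lambda>\<omega>. (S \<omega> + Z \<omega>)\<^sup>2) \<le> C * real (Suc p)"
      using m2 IH(3) Z2 by (simp add: algebra_simps)
    show ?case
      using i4 m1 b2 b4 by (simp add: S_def Z_def)
  qed
  show "integrable M (\<lambda>\<omega>. (\<Sum>l<n. Y l \<omega>) ^ 4)"
    and "expectation (\<lambda>\<omega>. (\<Sum>l<n. Y l \<omega>) ^ 4) \<le> 4 * C\<^sup>2 * (real n)\<^sup>2"
    using main[of n] by auto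
qed

text \<open>The averages have fourth moments of order 1/n^2, which are summable. Hence the series of
  their fourth powers has finite expectation, so it converges almost surely and its terms tend to
  0.\<close>

lemma (in prob_space) strong_law_fourth_moment_centered:
  fixes Y :: "nat \<Rightarrow> 'a \<Rightarrow> real"
  assumes indep: "indep_vars (\<lambda>_. borel) Y UNIV"
    and int: "\<And>l. integrable M (\<lambda>\<omega>. Y l \<omega> ^ 4)"
    and cent: "\<And>l. expectation (Y l) = 0"
    and bound: "\<And>l. expectation (\<lambda>\<omega>. Y l \<omega> ^ 4) \<le> C"
  shows "AE \<omega> in M. (\<lambda>n. (\<Sum>l<n. Y l \<omega>) / real n) \<longlonglongrightarrow> 0"
proof -
  define D where "D = max C 1"
  have [measurable]: "Y l \<in> borel_measurable M" for l
    using indep by (simp add: indep_vars_def)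
  have indn: "indep_vars (\<lambda>_. borel) Y {..<n}" for n
    by (rule indep_vars_subset[OF indep]) simp
  have bD: "expectation (\<lambda>\<omega>. Y l \<omega> ^ 4) \<le> D" for l
    using bound[of l] by (simp add: D_def)
  have D1: "1 \<le> D" by (simp add: D_def)
  note fm = fourth_moment_sum[OF indn int cent bD D1]
  define Q where "Q = (\<lambda>n \<omega>. ((\<Sum>l<n. Y l \<omega>) / real n) ^ 4)"
  have [measurable]: "Q n \<in> borel_measurable M" for n
    unfolding Q_def by measurable
  have Qb: "(\<integral>\<^sup>+\<omega>. ennreal (Q n \<omega>) \<partial>M) \<le> ennreal (4 * D\<^sup>2 * (1 / (real n)\<^sup>2))" for n
  proof -
    have i: "integrable M (Q n)"
      unfolding Q_def power_divide using fm(1)[of n] by simp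
    have "expectation (Q n) = expectation (\<lambda>\<omega>. (\<Sum>l<n. Y l \<omega>) ^ 4) / real n ^ 4"
      unfolding Q_def power_divide by simp
    also have "\<dots> \<le> (4 * D\<^sup>2 * (real n)\<^sup>2) / real n ^ 4"
      using fm(2)[of n] by (intro divide_right_mono) auto
    also have "\<dots> = 4 * D\<^sup>2 * (1 / (real n)\<^sup>2)"
      by (simp add: power4_eq_xxxx power2_eq_square)
    finally show ?thesis
      using i by (subst nn_integral_eq_integral) (auto simp: Q_def intro!: ennreal_leI)
  qed
  have "(\<integral>\<^sup>+\<omega>. (\<Sum>n. ennreal (Q n \<omega>)) \<partial>M) = (\<Sum>n. \<integral>\<^sup>+\<omega>. ennreal (Q n \<omega>) \<partial>M)"
    by (intro nn_integral_suminf) simp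
  also have "\<dots> \<le> (\<Sum>n. ennreal (4 * D\<^sup>2 * (1 / (real n)\<^sup>2)))"
    using Qb by (intro suminf_le) auto
  also have "\<dots> < \<infinity>"
  proof -
    have "summable (\<lambda>n. 4 * D\<^sup>2 * (1 / (real n)\<^sup>2))"
      using inverse_power_summable[of 2, where 'a=real] by (intro summable_mult) (simp add: inverse_eq_divide)
    then show ?thesis
      by (simp add: suminf_ennreal2 less_top[symmetric])
  qed
  finally have "(\<integral>\<^sup>+\<omega>. (\<Sum>n. ennreal (Q n \<omega>)) \<partial>M) \<noteq> \<infinity>" by simp
  then have "AE \<omega> in M. (\<Sum>n. ennreal (Q n \<omega>)) \<noteq> \<infinity>"
    by (intro nn_integral_PInf_AE) measurable
  then show ?thesis
  proof (rule AE_mp, intro AE_I2 impI)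
    fix \<omega> assume "(\<Sum>n. ennreal (Q n \<omega>)) \<noteq> \<infinity>"
    then have "summable (\<lambda>n. Q n \<omega>)"
      by (intro summable_suminf_not_top) (auto simp: Q_def)
    then have "(\<lambda>n. Q n \<omega>) \<longlonglongrightarrow> 0" by (rule summable_LIMSEQ_zero)
    then have "(\<lambda>n. root 4 (Q n \<omega>)) \<longlonglongrightarrow> root 4 0" by (intro tendsto_intros)
    moreover have "root 4 (Q n \<omega>) = \<bar>(\<Sum>l<n. Y l \<omega>) / real n\<bar>" for n
      unfolding Q_def by (rule real_root_pos_unique) (simp_all add: power_even_abs del: abs_divide)
    ultimately have "(\<lambda>n. \<bar>(\<Sum>l<n. Y l \<omega>) / real n\<bar>) \<longlonglongrightarrow> 0"
      by simp
    then show "(\<lambda>n. (\<Sum>l<n. Y l \<omega>) / real n) \<longlonglongrightarrow> 0"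
      by (rule tendsto_rabs_zero_cancel)
  qed
qed

text \<open>Integrals of functions of \<open>V l\<close> depend only on its distribution, so they
  can be computed at \<open>V\<^sub>0\<close>. This supplies the hypotheses of the fourth moment
  bound and of the strong law for the centered variables.\<close>

lemma (in prob_space) iid_copies_centered:
  fixes g :: "'b \<Rightarrow> real"
  assumes iid: "iid_copies M N I V V\<^sub>0"
    and V0 [measurable]: "V\<^sub>0 \<in> measurable M N" and g [measurable]: "g \<in> borel_measurable N"
    and int: "integrable M (\<lambda>\<omega>. g (V\<^sub>0 \<omega>) ^ 4)"
  defines "\<mu> \<equiv> expectation (\<lambda>\<omega>. g (V\<^sub>0 \<omega>))"
  shows "indep_vars (\<lambda>_. borel) (\<lambda>l \<omega>. g (V l \<omega>) - \<mu>) I"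
    and "\<And>l. l \<in> I \<Longrightarrow> integrable M (\<lambda>\<omega>. (g (V l \<omega>) - \<mu>) ^ 4)"
    and "\<And>l. l \<in> I \<Longrightarrow> expectation (\<lambda>\<omega>. g (V l \<omega>) - \<mu>) = 0"
    and "\<And>l. l \<in> I \<Longrightarrow>
      expectation (\<lambda>\<omega>. (g (V l \<omega>) - \<mu>) ^ 4) = expectation (\<lambda>\<omega>. (g (V\<^sub>0 \<omega>) - \<mu>) ^ 4)"
proof -
  have ind: "indep_vars (\<lambda>_. N) V I" and dist: "\<And>l. l \<in> I \<Longrightarrow> distr M N (V l) = distr M N V\<^sub>0"
    using iid by (auto simp: iid_copies_def)
  show "indep_vars (\<lambda>_. borel) (\<lambda>l \<omega>. g (V l \<omega>) - \<mu>) I"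
    by (rule indep_vars_compose2[OF ind, where Y = "\<lambda>_ x. g x - \<mu>"]) measurable
  have V: "V l \<in> measurable M N" if "l \<in> I" for l
    using ind that by (simp add: indep_vars_def)
  have transfer_int: "integrable M (\<lambda>\<omega>. h (V l \<omega>)) \<longleftrightarrow> integrable M (\<lambda>\<omega>. h (V\<^sub>0 \<omega>))"
    and transfer_exp: "expectation (\<lambda>\<omega>. h (V l \<omega>)) = expectation (\<lambda>\<omega>. h (V\<^sub>0 \<omega>))"
    if "l \<in> I" "h \<in> borel_measurable N" for l and h :: "'b \<Rightarrow> real"
    using integrable_distr_eq[OF V[OF that(1)] that(2)] integrable_distr_eq[OF V0 that(2)]
      integral_distr[OF V[OF that(1)] that(2)] integral_distr[OF V0 that(2)] dist[OF that(1)]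
    by simp_all
  have gi: "integrable M (\<lambda>\<omega>. g (V\<^sub>0 \<omega>) ^ k)" if "k \<le> 4" for k
    by (rule integrable_power_le_4[OF _ int that]) simp
  have "integrable M (\<lambda>\<omega>. (g (V\<^sub>0 \<omega>) - \<mu>) ^ 4)"
  proof -
    have "(\<lambda>\<omega>. (g (V\<^sub>0 \<omega>) - \<mu>) ^ 4)
        = (\<lambda>\<omega>. \<Sum>k\<le>4. of_nat (4 choose k) * g (V\<^sub>0 \<omega>) ^ k * (- \<mu>) ^ (4 - k))"
      by (intro ext) (metis binomial_ring uminus_add_conv_diff add.commute)
    then show ?thesis using gi by auto
  qed
  then show "integrable M (\<lambda>\<omega>. (g (V l \<omega>) - \<mu>) ^ 4)" if "l \<in> I" for l
    using transfer_int[OF that, of "\<lambda>x. (g x - \<mu>) ^ 4"] by simp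
  show "expectation (\<lambda>\<omega>. (g (V l \<omega>) - \<mu>) ^ 4) = expectation (\<lambda>\<omega>. (g (V\<^sub>0 \<omega>) - \<mu>) ^ 4)"
    if "l \<in> I" for l
    using transfer_exp[OF that, of "\<lambda>x. (g x - \<mu>) ^ 4"] by simp
  show "expectation (\<lambda>\<omega>. g (V l \<omega>) - \<mu>) = 0" if "l \<in> I" for l
    using transfer_exp[OF that, of "\<lambda>x. g x - \<mu>"] gi[of 1] by (simp add: \<mu>_def prob_space)
qed

lemma (in prob_space) strong_law_iid_copies:
  fixes g :: "'b \<Rightarrow> real"
  assumes "iid_copies M N UNIV V V\<^sub>0" "V\<^sub>0 \<in> measurable M N" "g \<in> borel_measurable N"
    and "integrable M (\<lambda>\<omega>. g (V\<^sub>0 \<omega>) ^ 4)"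
  shows "AE \<omega> in M. (\<lambda>n. (\<Sum>l<n. g (V l \<omega>)) / real n) \<longlonglongrightarrow> expectation (\<lambda>\<omega>. g (V\<^sub>0 \<omega>))"
proof -
  define \<mu> where "\<mu> = expectation (\<lambda>\<omega>. g (V\<^sub>0 \<omega>))"
  note c = iid_copies_centered[OF assms, folded \<mu>_def]
  have "AE \<omega> in M. (\<lambda>n. (\<Sum>l<n. g (V l \<omega>) - \<mu>) / real n) \<longlonglongrightarrow> 0"
    by (rule strong_law_fourth_moment_centered[OF c(1,2,3)]) (auto simp: c(4))
  then show ?thesis
    unfolding \<mu>_def[symmetric]
  proof (rule AE_mp, intro AE_I2 impI)
    fix \<omega> assume "(\<lambda>n. (\<Sum>l<n. g (V l \<omega>) - \<mu>) / real n) \<longlonglongrightarrow> 0"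
    \<comment> \<open>The identity can fail at n = 0, where both quotients are 0 and the right side
      is -\<mu>.\<close>
    moreover have "eventually (\<lambda>n. (\<Sum>l<n. g (V l \<omega>) - \<mu>) / real n = (\<Sum>l<n. g (V l \<omega>)) / real n - \<mu>) sequentially"
      using eventually_gt_at_top[of 0]
      by eventually_elim (simp add: sum_subtractf diff_divide_distrib)
    ultimately have "(\<lambda>n. (\<Sum>l<n. g (V l \<omega>)) / real n - \<mu>) \<longlonglongrightarrow> 0"
      using Lim_transform_eventually by fast
    then show "(\<lambda>n. (\<Sum>l<n. g (V l \<omega>)) / real n) \<longlonglongrightarrow> \<mu>"
      by (simp add: LIM_zero_iff)
  qed
qed

text \<open>Markov's inequality for the fourth power of the centered sum. The bound depends on the
  sample only through its size and the law of \<open>V\<^sub>0\<close>, which permits a fresh finite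
  sample for each budget.\<close>

lemma (in prob_space) iid_copies_mean_deviation:
  fixes g :: "'b \<Rightarrow> real"
  assumes iid: "iid_copies M N {..<n} V V\<^sub>0" and "V\<^sub>0 \<in> measurable M N" "g \<in> borel_measurable N"
    and "integrable M (\<lambda>\<omega>. g (V\<^sub>0 \<omega>) ^ 4)" and "0 < n" "0 < \<eta>"
  defines "\<mu> \<equiv> expectation (\<lambda>\<omega>. g (V\<^sub>0 \<omega>))"
  shows "prob {\<omega> \<in> space M. \<eta> \<le> \<bar>(\<Sum>l<n. g (V l \<omega>)) / real n - \<mu>\<bar>}
    \<le> 4 * (max 1 (expectation (\<lambda>\<omega>. (g (V\<^sub>0 \<omega>) - \<mu>) ^ 4)))\<^sup>2 / \<eta> ^ 4 / (real n)\<^sup>2"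
proof -
  define D where "D = max 1 (expectation (\<lambda>\<omega>. (g (V\<^sub>0 \<omega>) - \<mu>) ^ 4))"
  note c = iid_copies_centered[OF assms(1-4), folded \<mu>_def]
  define Q where "Q = (\<lambda>\<omega>. (\<Sum>l<n. g (V l \<omega>) - \<mu>) ^ 4)"
  have Q: "integrable M Q" "expectation Q \<le> 4 * D\<^sup>2 * (real n)\<^sup>2"
    using fourth_moment_sum[OF c(1,2,3), of D] unfolding Q_def by (auto simp: c(4) D_def)
  have mean: "(\<Sum>l<n. g (V l \<omega>)) / real n - \<mu> = (\<Sum>l<n. g (V l \<omega>) - \<mu>) / real n" for \<omega>
    using \<open>0 < n\<close> by (simp add: sum_subtractf diff_divide_distrib)
  have "{\<omega> \<in> space M. \<eta> \<le> \<bar>(\<Sum>l<n. g (V l \<omega>)) / real n - \<mu>\<bar>} \<subseteq> {\<omega> \<in> space M. (\<eta> * real n) ^ 4 \<le> Q \<omega>}"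
  proof safe
    fix \<omega> assume "\<eta> \<le> \<bar>(\<Sum>l<n. g (V l \<omega>)) / real n - \<mu>\<bar>"
    then have "\<eta> * real n \<le> \<bar>\<Sum>l<n. g (V l \<omega>) - \<mu>\<bar>"
      using \<open>0 < n\<close> unfolding mean by (simp add: field_simps)
    then have "(\<eta> * real n) ^ 4 \<le> \<bar>\<Sum>l<n. g (V l \<omega>) - \<mu>\<bar> ^ 4"
      using \<open>0 < \<eta>\<close> by (intro power_mono) auto
    then show "(\<eta> * real n) ^ 4 \<le> Q \<omega>" by (simp add: Q_def)
  qed
  then have "prob {\<omega> \<in> space M. \<eta> \<le> \<bar>(\<Sum>l<n. g (V l \<omega>)) / real n - \<mu>\<bar>}
      \<le> prob {\<omega> \<in> space M. (\<eta> * real n) ^ 4 \<le> Q \<omega>}"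
    using borel_measurable_integrable[OF Q(1)] by (intro finite_measure_mono) measurable
  also have "\<dots> \<le> expectation Q / (\<eta> * real n) ^ 4"
    using Q(1) \<open>0 < n\<close> \<open>0 < \<eta>\<close>
    by (intro integral_Markov_inequality_measure[where A = "{}"]) (auto simp: Q_def)
  also have "\<dots> \<le> (4 * D\<^sup>2 * (real n)\<^sup>2) / (\<eta> * real n) ^ 4"
    using Q(2) by (intro divide_right_mono) auto
  also have "\<dots> = 4 * D\<^sup>2 / \<eta> ^ 4 / (real n)\<^sup>2"
    by (simp add: power_mult_distrib power4_eq_xxxx power2_eq_square)
  finally show ?thesis by (simp add: D_def)
qed

text \<open>A union bound over the coordinates reduces the claim to the scalar estimate, whose rate
  involves \<open>k\<close> only through \<open>N k\<close>.\<close>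

lemma (in prob_space) iid_copies_vec_mean_deviation_tendsto:
  fixes R :: "'a \<Rightarrow> real ^ 'd"
  assumes iid: "\<And>k. iid_copies M borel {..<N k} (T k) R" and R: "R \<in> borel_measurable M"
    and int: "\<And>j. integrable M (\<lambda>\<omega>. (R \<omega> $ j) ^ 4)"
    and N: "filterlim N at_top sequentially" and \<eta>: "0 < \<eta>"
  shows "(\<lambda>k. prob {\<omega> \<in> space M. \<eta> < norm ((1 / real (N k)) *\<^sub>R (\<Sum>l<N k. T k l \<omega>)
    - (\<chi> j. expectation (\<lambda>\<omega>. R \<omega> $ j)))}) \<longlonglongrightarrow> 0"
proof -
  define \<mu> where "\<mu> = (\<lambda>j. expectation (\<lambda>\<omega>. R \<omega> $ j))"
  \<comment> \<open>Coordinates off by at most \<eta> / d each, d being the dimension, give an l1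
    norm, hence a Euclidean norm, of at most \<eta>.\<close>
  define \<eta>' where "\<eta>' = \<eta> / real CARD('d)"
  have \<eta>': "0 < \<eta>'" using \<eta> by (simp add: \<eta>'_def)
  define D where "D = (\<lambda>j. 4 * (max 1 (expectation (\<lambda>\<omega>. (R \<omega> $ j - \<mu> j) ^ 4)))\<^sup>2 / \<eta>' ^ 4)"
  define P where "P = (\<lambda>k. prob {\<omega> \<in> space M. \<eta> < norm ((1 / real (N k)) *\<^sub>R (\<Sum>l<N k. T k l \<omega>) - (\<chi> j. \<mu> j))})"
  have nth: "(\<lambda>v :: real ^ 'd. v $ j) \<in> borel_measurable borel" for j
    using borel_measurable_vec_nth_iff[of "\<lambda>v::real^'d. v" borel] by simp
  \<comment> \<open>For \<open>N k = 0\<close> the bound would read \<open>P k \<le> 0\<close>, as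
    division by zero yields 0; there are only finitely many such \<open>k\<close>.\<close>
  have bound: "P k \<le> (\<Sum>j\<in>UNIV. D j / (real (N k))\<^sup>2)" if "0 < N k" for k
  proof -
    define E where "E = (\<lambda>j. {\<omega> \<in> space M. \<eta>' \<le> \<bar>(\<Sum>l<N k. T k l \<omega> $ j) / real (N k) - \<mu> j\<bar>})"
    have [measurable]: "(\<lambda>\<omega>. T k l \<omega> $ j) \<in> borel_measurable M" if "l < N k" for l j
      using iid[of k] that measurable_compose[OF _ nth] by (auto simp: iid_copies_def indep_vars_def)
    have [measurable]: "(\<lambda>\<omega>. \<Sum>l<N k. T k l \<omega> $ j) \<in> borel_measurable M" for j
      by (intro borel_measurable_sum) auto
    have E: "E j \<in> events" for j
      unfolding E_def by measurable
    have "{\<omega> \<in> space M. \<eta> < norm ((1 / real (N k)) *\<^sub>R (\<Sum>l<N k. T k l \<omega>) - (\<chi> j. \<mu> j))} \<subseteq> (\<Union>j\<in>UNIV. E j)"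
    proof (rule subsetI, rule ccontr)
      fix \<omega> assume *: "\<omega> \<in> {\<omega> \<in> space M. \<eta> < norm ((1 / real (N k)) *\<^sub>R (\<Sum>l<N k. T k l \<omega>) - (\<chi> j. \<mu> j))}"
        and **: "\<omega> \<notin> (\<Union>j\<in>UNIV. E j)"
      let ?v = "(1 / real (N k)) *\<^sub>R (\<Sum>l<N k. T k l \<omega>) - (\<chi> j. \<mu> j)"
      have "\<bar>?v $ j\<bar> \<le> \<eta>'" for j
        using * ** by (auto simp: E_def not_le less_imp_le)
      then have "(\<Sum>j\<in>UNIV. \<bar>?v $ j\<bar>) \<le> (\<Sum>j\<in>(UNIV::'d set). \<eta>')"
        by (intro sum_mono)
      also have "\<dots> = \<eta>" by (simp add: \<eta>'_def)
      finally have "norm ?v \<le> \<eta>" using norm_le_l1_cart[of ?v] by linarith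
      with * show False by auto
    qed
    then have "P k \<le> prob (\<Union>j\<in>UNIV. E j)"
      unfolding P_def using E by (intro finite_measure_mono) auto
    also have "\<dots> \<le> (\<Sum>j\<in>UNIV. prob (E j))"
      using E by (intro finite_measure_subadditive_finite) auto
    also have "\<dots> \<le> (\<Sum>j\<in>UNIV. D j / (real (N k))\<^sup>2)"
      unfolding E_def D_def \<mu>_def
      by (intro sum_mono iid_copies_mean_deviation[OF iid R nth int that \<eta>'])
    finally show ?thesis .
  qed
  have "(\<lambda>k. \<Sum>j\<in>(UNIV::'d set). D j / (real (N k))\<^sup>2) \<longlonglongrightarrow> (\<Sum>j\<in>(UNIV::'d set). 0)"
  proof (intro tendsto_sum)
    fix j
    have "(\<lambda>x. D j / (real x)\<^sup>2) \<longlonglongrightarrow> 0"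
      by (intro tendsto_divide_0[OF tendsto_const] filterlim_at_top_imp_at_infinity
          filterlim_pow_at_top filterlim_real_sequentially) simp
    from filterlim_compose[OF this N] show "(\<lambda>k. D j / (real (N k))\<^sup>2) \<longlonglongrightarrow> 0" .
  qed
  then have lim: "(\<lambda>k. \<Sum>j\<in>(UNIV::'d set). D j / (real (N k))\<^sup>2) \<longlonglongrightarrow> 0" by simp
  have "P \<longlonglongrightarrow> 0"
  proof (rule tendsto_sandwich[OF _ _ tendsto_const lim])
    show "\<forall>\<^sub>F k in sequentially. P k \<le> (\<Sum>j\<in>UNIV. D j / (real (N k))\<^sup>2)"
      using eventually_compose_filterlim[OF eventually_gt_at_top[of 0] N]
      by eventually_elim (rule bound)
  qed (simp add: P_def)
  then show ?thesis by (simp add: P_def \<mu>_def)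
qed

section \<open>Least squares by Cramer's rule\<close>

lemma borel_measurable_det:
  fixes A :: "'a \<Rightarrow> real ^ 'd ^ 'd"
  assumes [measurable]: "\<And>i j. (\<lambda>x. A x $ i $ j) \<in> borel_measurable M"
  shows "(\<lambda>x. det (A x)) \<in> borel_measurable M"
  unfolding det_def by measurable

lemma tendsto_det:
  fixes A :: "'a \<Rightarrow> real ^ 'd ^ 'd"
  assumes "\<And>i j. ((\<lambda>x. A x $ i $ j) \<longlongrightarrow> L $ i $ j) F"
  shows "((\<lambda>x. det (A x)) \<longlongrightarrow> det L) F"
  unfolding det_def by (intro tendsto_intros assms)

text \<open>The quotients of Cramer's rule: column \<open>k\<close> of \<open>A\<close> is replaced
  by \<open>b\<close> in the numerator. Being a quotient of polynomials in the entries, it makes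
  measurability and limits accessible, unlike \<open>matrix_inv\<close>, which is given by
  choice.\<close>

definition cramer_solution :: "real ^ 'd ^ 'd \<Rightarrow> real ^ 'd \<Rightarrow> real ^ 'd" where
  "cramer_solution A b = (\<chi> k. det (\<chi> i j. if j = k then b $ i else A $ i $ j) / det A)"

lemma matrix_inv_mult_eq_cramer_solution:
  assumes "det A \<noteq> 0"
  shows "matrix_inv A *v b = cramer_solution A b"
proof -
  have "\<exists>B. A ** B = mat 1 \<and> B ** A = mat 1"
    using assms by (simp add: invertible_det_nz[symmetric] invertible_def)
  then have "A ** matrix_inv A = mat 1"
    unfolding matrix_inv_def by (rule someI2_ex) simp
  then have "A *v (matrix_inv A *v b) = b"
    by (simp add: matrix_vector_mul_assoc)
  then show ?thesis
    using cramer[OF assms] by (simp add: cramer_solution_def)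
qed

text \<open>The junk value of \<^const>\<open>matrix_inv\<close> is the same for all singular matrices, so that
  least squares is a measurable function of the data even where the rank drops.\<close>

lemma matrix_inv_singular:
  fixes A :: "real ^ 'd ^ 'd"
  assumes "det A = 0"
  shows "matrix_inv A = (SOME B. False)"
proof -
  have "\<nexists>B. A ** B = mat 1 \<and> B ** A = mat 1"
    using assms by (simp add: invertible_det_nz flip: invertible_def)
  then have "(\<lambda>B. A ** B = mat 1 \<and> B ** A = mat 1) = (\<lambda>B. False)" by blast
  then show ?thesis unfolding matrix_inv_def by (rule arg_cong)
qed

lemma borel_measurable_matrix_inv_mult:
  fixes A :: "'a \<Rightarrow> real ^ 'd ^ 'd"
  assumes A [measurable]: "\<And>i j. (\<lambda>x. A x $ i $ j) \<in> borel_measurable M"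
    and b [measurable]: "\<And>i. (\<lambda>x. b x $ i) \<in> borel_measurable M"
  shows "(\<lambda>x. matrix_inv (A x) *v b x) \<in> borel_measurable M"
proof -
  have [measurable]: "(\<lambda>x. det (A x)) \<in> borel_measurable M"
    by (rule borel_measurable_det) simp
  have [measurable]: "(\<lambda>x. det (\<chi> i j. if j = k then b x $ i else A x $ i $ j)) \<in> borel_measurable M" for k
    by (rule borel_measurable_det) (simp, measurable)
  \<comment> \<open>On the measurable set where the determinant vanishes the inverse is one fixed
    matrix, so the map is linear in \<open>b\<close> there; elsewhere Cramer's rule applies.\<close>
  have "(\<lambda>x. matrix_inv (A x) *v b x) = (\<lambda>x. if det (A x) \<noteq> 0 then cramer_solution (A x) (b x)
      else (SOME B. False) *v b x)"
    by (auto simp: matrix_inv_mult_eq_cramer_solution matrix_inv_singular)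
  also have "\<dots> \<in> borel_measurable M"
  proof (rule measurable_If)
    show "(\<lambda>x. cramer_solution (A x) (b x)) \<in> borel_measurable M"
      unfolding borel_measurable_vec_nth_iff cramer_solution_def by (simp, measurable)
    show "(\<lambda>x. (SOME B. False) *v b x) \<in> borel_measurable M"
      unfolding borel_measurable_vec_nth_iff matrix_vector_mult_def by (simp, measurable)
  qed measurable
  finally show ?thesis .
qed

lemma borel_measurable_least_squares:
  fixes Z :: "'a \<Rightarrow> nat \<Rightarrow> real ^ 'd"
  assumes [measurable]: "\<And>l j. (\<lambda>x. Z x l $ j) \<in> borel_measurable M" "\<And>l. (\<lambda>x. y x l) \<in> borel_measurable M"
  shows "(\<lambda>x. least_squares m (Z x) (y x)) \<in> borel_measurable M"
  unfolding least_squares_def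
  by (rule borel_measurable_matrix_inv_mult; simp add: gram_def transpose_mult_def; measurable)

text \<open>A deterministic statement about one data sequence. Dividing the normal equations by m >
  0 does not change their solution, and the scaled coefficients converge to \<open>L\<close> and
  \<open>L *v \<beta>\<close>, where Cramer's rule is continuous because \<open>det L\<close> is
  nonzero.\<close>

lemma least_squares_tendsto:
  fixes Z :: "nat \<Rightarrow> real ^ 'd"
  assumes G: "\<And>i j. (\<lambda>m. (\<Sum>l<m. Z l $ i * Z l $ j) / real m) \<longlonglongrightarrow> L $ i $ j"
    and v: "\<And>j. (\<lambda>m. (\<Sum>l<m. Z l $ j * y l) / real m) \<longlonglongrightarrow> (L *v \<beta>) $ j"
    and L: "det L \<noteq> 0"
  shows "(\<lambda>m. least_squares m Z y) \<longlonglongrightarrow> \<beta>"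
proof -
  define A where "A = (\<lambda>m. \<chi> i j. gram m Z $ i $ j / real m)"
  define b where "b = (\<lambda>m. \<chi> j. transpose_mult m Z y $ j / real m)"
  have A: "(\<lambda>m. A m $ i $ j) \<longlonglongrightarrow> L $ i $ j" for i j
    using G by (simp add: A_def gram_def)
  have b: "(\<lambda>m. b m $ j) \<longlonglongrightarrow> (L *v \<beta>) $ j" for j
    using v by (simp add: b_def transpose_mult_def)
  have dA: "(\<lambda>m. det (A m)) \<longlonglongrightarrow> det L"
    by (intro tendsto_det A)
  have "(\<lambda>m. cramer_solution (A m) (b m)) \<longlonglongrightarrow> cramer_solution L (L *v \<beta>)"
  proof (rule vec_tendstoI)
    fix k
    show "(\<lambda>m. cramer_solution (A m) (b m) $ k) \<longlonglongrightarrow> cramer_solution L (L *v \<beta>) $ k"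
      unfolding cramer_solution_def vec_lambda_beta
      by (intro tendsto_divide dA L tendsto_det) (simp add: A b)
  qed
  moreover have "cramer_solution L (L *v \<beta>) = \<beta>"
    using cramer[OF L, of \<beta> "L *v \<beta>"] by (simp add: cramer_solution_def)
  \<comment> \<open>The determinant of the scaled Gram matrix is eventually nonzero, so that both
    systems then have exactly one solution; m > 0 allows the scaling to be undone.\<close>
  moreover have "eventually (\<lambda>m. cramer_solution (A m) (b m) = least_squares m Z y) sequentially"
    using tendsto_imp_eventually_ne[OF dA L] eventually_gt_at_top[of 0]
  proof eventually_elim
    case (elim m)
    have gA: "gram m Z = (\<chi> i. real m *s (A m $ i))"
      using elim by (simp add: A_def vec_eq_iff)
    have "det (gram m Z) = (\<Prod>i\<in>(UNIV::'d set). real m) * det (\<chi> i. A m $ i)"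
      unfolding gA by (rule det_rows_mul)
    then have nz: "det (gram m Z) \<noteq> 0"
      using elim by simp
    define x where "x = least_squares m Z y"
    have "gram m Z *v x = transpose_mult m Z y"
      using cramer[OF nz, of x "transpose_mult m Z y"]
      by (simp add: x_def least_squares_def matrix_inv_mult_eq_cramer_solution[OF nz] cramer_solution_def)
    then have "(\<Sum>j\<in>UNIV. gram m Z $ i $ j * x $ j) = transpose_mult m Z y $ i" for i
      by (simp add: vec_eq_iff matrix_vector_mult_def)
    then have "A m *v x = b m"
      by (simp add: vec_eq_iff matrix_vector_mult_def A_def b_def flip: sum_divide_distrib)
    then show ?case
      using cramer[of "A m" x "b m"] elim by (simp add: x_def cramer_solution_def)
  qed
  ultimately show ?thesis
    using Lim_transform_eventually by fastforce
qed

section \<open>Conditional probabilities under independence\<close>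

text \<open>The constant \<open>prob D\<close> is measurable for \<open>F\<close> and has the right
  integral over each set of \<open>F\<close>, which characterises the conditional probability up to
  null sets.\<close>

lemma (in prob_space) real_cond_exp_indicator_indep:
  assumes sub: "subalgebra M F" and D: "D \<in> events"
    and ind: "\<And>A. A \<in> sets F \<Longrightarrow> prob (A \<inter> D) = prob A * prob D"
  shows "AE \<omega> in M. real_cond_exp M F (indicator D) \<omega> = prob D"
proof -
  interpret finite_measure_subalgebra M F
    by unfold_locales (rule sub)
  show ?thesis
  proof (rule real_cond_exp_charact)
    fix A assume A: "A \<in> sets F"
    then have "A \<in> events" using sub by (auto simp: subalgebra_def)
    then show "(\<integral>x\<in>A. indicator D x \<partial>M) = (\<integral>x\<in>A. prob D \<partial>M)"
      using D ind[OF A] sets.sets_into_space[OF D]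
      by (simp add: set_lebesgue_integral_def Int_absorb2 flip: indicator_inter_arith)
  qed (use D in \<open>auto intro!: integrable_real_indicator simp: emeasure_eq_measure\<close>)
qed

text \<open>A union bound under conditioning. Since \<open>G\<close> lies in \<open>F\<close>, its
  conditional probability is its own indicator; since \<open>D\<close> is independent of
  \<open>F\<close>, its conditional probability is constant.\<close>

lemma (in prob_space) real_cond_exp_indicator_bounds:
  assumes sub: "subalgebra M F" and A: "A \<in> events" and G: "G \<in> sets F" and D: "D \<in> events"
    and AGD: "A \<subseteq> G \<union> D"
    and ind: "\<And>E. E \<in> sets F \<Longrightarrow> prob (E \<inter> D) = prob E * prob D"
  shows "AE \<omega> in M. 0 \<le> real_cond_exp M F (indicator A) \<omega>
    \<and> real_cond_exp M F (indicator A) \<omega> \<le> indicator G \<omega> + prob D"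
proof -
  interpret finite_measure_subalgebra M F
    by unfold_locales (rule sub)
  have G': "G \<in> events" using sub G by (auto simp: subalgebra_def)
  have int: "integrable M (indicator B :: 'a \<Rightarrow> real)" if "B \<in> events" for B
    using that by (intro integrable_real_indicator) (auto simp: emeasure_eq_measure)
  have "AE \<omega> in M. real_cond_exp M F (indicator A) \<omega>
      \<le> real_cond_exp M F (\<lambda>x. indicator G x + indicator D x) \<omega>"
    using AGD by (intro real_cond_exp_mono AE_I2 int A Bochner_Integration.integrable_add G' D)
      (auto simp: indicator_def)
  moreover have "AE \<omega> in M. real_cond_exp M F (\<lambda>x. indicator G x + indicator D x) \<omega>
      = real_cond_exp M F (indicator G) \<omega> + real_cond_exp M F (indicator D) \<omega>"
    by (intro real_cond_exp_add int G' D)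
  moreover have "AE \<omega> in M. real_cond_exp M F (indicator G) \<omega> = indicator G \<omega>"
    by (intro real_cond_exp_F_meas int G' borel_measurable_indicator G)
  moreover have "AE \<omega> in M. real_cond_exp M F (indicator D) \<omega> = prob D"
    by (rule real_cond_exp_indicator_indep[OF sub D ind])
  moreover have "AE \<omega> in M. 0 \<le> real_cond_exp M F (indicator A) \<omega>"
    using A by (intro real_cond_exp_pos) auto
  ultimately show ?thesis by eventually_elim auto
qed

text \<open>Applying a measurable map can only shrink the generated \<sigma>-algebra, and
  independence is inherited by smaller families.\<close>

lemma (in prob_space) indep_rvs_compose:
  assumes ind: "indep_rvs M N\<^sub>1 U N\<^sub>2 V"
    and f: "f \<in> measurable N\<^sub>1 L\<^sub>1" and g: "g \<in> measurable N\<^sub>2 L\<^sub>2"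
  shows "indep_rvs M L\<^sub>1 (\<lambda>\<omega>. f (U \<omega>)) L\<^sub>2 (\<lambda>\<omega>. g (V \<omega>))"
proof -
  have U: "U \<in> measurable M N\<^sub>1" and V: "V \<in> measurable M N\<^sub>2"
    using ind by (auto simp: indep_rvs_def)
  have sub: "sets (vimage_algebra (space M) (\<lambda>\<omega>. h (W \<omega>)) L) \<subseteq> sets (vimage_algebra (space M) W N)"
    if W: "W \<in> measurable M N" and h: "h \<in> measurable N L" for h W and N :: "'x measure" and L :: "'y measure"
  proof -
    have "W \<in> measurable (vimage_algebra (space M) W N) N"
      using measurable_space[OF W] by (intro measurable_vimage_algebra1) auto
    from measurable_compose[OF this h] show ?thesis
      by (intro sets_image_in_sets) auto
  qed
  show ?thesis
    using ind measurable_compose[OF U f] measurable_compose[OF V g] sub[OF U f] sub[OF V g]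
    unfolding indep_rvs_def indep_sets2_eq by blast
qed

text \<open>For two variables of the same type this gives access to the product rule for
  expectations.\<close>

lemma (in prob_space) indep_rvs_iff_indep_var: "indep_rvs M N\<^sub>1 U N\<^sub>2 V \<longleftrightarrow> indep_var N\<^sub>1 U N\<^sub>2 V"
  by (simp add: indep_rvs_def indep_var_eq sets_vimage_algebra)

section \<open>Moments of the linear model\<close>

text \<open>One term of the exponential series gives t^k \<le> k! exp t. With t = (|W| / C)^\<alpha>
  and \<alpha> k = j the left side is (|W| / C)^j, so |W|^j is dominated by a multiple of an
  integrable exponential.\<close>

lemma (in prob_space) psi_norm_finite_imp_integrable:
  assumes W [measurable]: "W \<in> borel_measurable M" and fin: "psi_norm M \<alpha> W < \<infinity>"
    and \<alpha>: "0 < \<alpha>" "\<alpha> * real k = real j"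
  shows "integrable M (\<lambda>\<omega>. \<bar>W \<omega>\<bar> ^ j)"
proof -
  have "\<exists>C>0. (\<integral>\<^sup>+ \<omega>. ennreal (exp (\<bar>W \<omega>\<bar> powr \<alpha> / C powr \<alpha>)) \<partial>M) \<le> 2"
  proof (rule ccontr)
    assume "\<not> ?thesis"
    \<comment> \<open>Without an admissible \<open>C\<close> the norm is the infimum of the empty
      set, which is \<infinity> in \<open>ennreal\<close>.\<close>
    then have "psi_norm M \<alpha> W = Inf (ennreal ` {})"
      unfolding psi_norm_def by (intro arg_cong[where f = Inf] arg_cong2[where f = image]) auto
    then show False using fin by simp
  qed
  then obtain C where C: "C > 0"
    and le: "(\<integral>\<^sup>+ \<omega>. ennreal (exp (\<bar>W \<omega>\<bar> powr \<alpha> / C powr \<alpha>)) \<partial>M) \<le> 2" by blast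
  define E where "E = (\<lambda>\<omega>. exp (\<bar>W \<omega>\<bar> powr \<alpha> / C powr \<alpha>))"
  have E: "integrable M E"
  proof (rule integrableI_nonneg)
    show "(\<integral>\<^sup>+ \<omega>. ennreal (E \<omega>) \<partial>M) < \<infinity>"
      using le unfolding E_def by (rule order.strict_trans1) simp
  qed (auto simp: E_def)
  show ?thesis
  proof (rule Bochner_Integration.integrable_bound)
    show "integrable M (\<lambda>\<omega>. C ^ j * fact k * E \<omega>)" using E by simp
    have "w ^ j \<le> C ^ j * fact k * exp (w powr \<alpha> / C powr \<alpha>)" if "0 \<le> w" for w
    proof -
      define t where "t = w powr \<alpha> / C powr \<alpha>"
      have "0 \<le> t" by (simp add: t_def)
      have "(\<Sum>i\<in>{k}. t ^ i /\<^sub>R fact i) \<le> (\<Sum>i. t ^ i /\<^sub>R fact i)"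
        using \<open>0 \<le> t\<close> by (intro sum_le_suminf summable_exp_generic) auto
      then have "t ^ k \<le> fact k * exp t"
        by (simp add: exp_def field_simps)
      moreover have "t ^ k = w ^ j / C ^ j"
      proof (cases "w = 0")
        case True
        \<comment> \<open>At w = 0 the claim compares 0^k with 0^j, and 0^0 = 1, so the exponents
          have to vanish together.\<close>
        have "k = 0 \<longleftrightarrow> j = 0" using \<alpha> by auto
        with True show ?thesis by (auto simp: t_def power_0_left)
      next
        case False
        then show ?thesis
          using C that \<alpha>(2) by (simp add: t_def power_divide powr_power powr_realpow mult.commute)
      qed
      ultimately have "w ^ j / C ^ j \<le> fact k * exp t" by simp
      then show ?thesis
        unfolding t_def[symmetric] using C by (simp add: field_simps)
    qed
    then show "AE \<omega> in M. norm (\<bar>W \<omega>\<bar> ^ j) \<le> norm (C ^ j * fact k * E \<omega>)"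
      using C by (auto simp: E_def)
  qed simp
qed

context prob_space
begin

context
  fixes R :: "'a \<Rightarrow> real ^ 'd" and fY :: "'a \<Rightarrow> real" and \<beta> :: "real ^ 'd" and \<epsilon> :: "'a \<Rightarrow> real"
    and \<sigma> :: real
  assumes model: "linear_model M R fY \<beta> \<epsilon> \<sigma>"
    and fY [measurable]: "fY \<in> borel_measurable M"
    and psi: "psi_norm M 1 (\<lambda>\<omega>. norm (R \<omega>)) < \<infinity>"
begin

lemma model_measurable [measurable]:
  "R \<in> borel_measurable M" "(\<lambda>\<omega>. R \<omega> $ j) \<in> borel_measurable M" "\<epsilon> \<in> borel_measurable M"
  using model borel_measurable_vec_nth_iff[of R M] by (auto simp: linear_model_def indep_rvs_def)

text \<open>Eighth moments are wanted because the strong law is applied to products of two variables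
  and asks for fourth moments of these products.\<close>

lemma integrable_norm_regressor_8: "integrable M (\<lambda>\<omega>. norm (R \<omega>) ^ 8)"
  using psi_norm_finite_imp_integrable[OF _ psi, of 8 8] by simp

lemma integrable_noise_8: "integrable M (\<lambda>\<omega>. \<bar>\<epsilon> \<omega>\<bar> ^ 8)"
  using psi_norm_finite_imp_integrable[of \<epsilon> 2 4 8] model
  by (simp add: linear_model_def sub_gaussian_def)

lemma model_AE: "AE \<omega> in M. fY \<omega> = R \<omega> \<bullet> \<beta> + \<epsilon> \<omega>"
  using model by (simp add: linear_model_def)

lemma integrable_response_8: "integrable M (\<lambda>\<omega>. \<bar>fY \<omega>\<bar> ^ 8)"
proof (rule Bochner_Integration.integrable_bound)
  show "integrable M (\<lambda>\<omega>. 2 ^ 8 * (norm (R \<omega>) ^ 8 * norm \<beta> ^ 8 + \<bar>\<epsilon> \<omega>\<bar> ^ 8))"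
    using integrable_norm_regressor_8 integrable_noise_8 by simp
  show "AE \<omega> in M. norm (\<bar>fY \<omega>\<bar> ^ 8) \<le> norm (2 ^ 8 * (norm (R \<omega>) ^ 8 * norm \<beta> ^ 8 + \<bar>\<epsilon> \<omega>\<bar> ^ 8))"
    using model_AE
  proof eventually_elim
    case (elim \<omega>)
    let ?a = "norm (R \<omega>) * norm \<beta>" and ?b = "\<bar>\<epsilon> \<omega>\<bar>"
    have "\<bar>fY \<omega>\<bar> \<le> ?a + ?b"
      using elim Cauchy_Schwarz_ineq2[of "R \<omega>" \<beta>] by linarith
    \<comment> \<open>Passing to the maximum gives (a + b)^8 \<le> 2^8 (a^8 + b^8) without expanding
      the power.\<close>
    also have "\<dots> \<le> 2 * max ?a ?b" by simp
    finally have "\<bar>fY \<omega>\<bar> ^ 8 \<le> (2 * max ?a ?b) ^ 8" by (intro power_mono) auto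
    also have "\<dots> = 2 ^ 8 * max ?a ?b ^ 8" by (rule power_mult_distrib)
    also have "\<dots> \<le> 2 ^ 8 * (?a ^ 8 + ?b ^ 8)"
      by (intro mult_left_mono) (auto simp: max_def)
    finally show ?case by (simp add: power_mult_distrib)
  qed
qed measurable

lemma integrable_regressor_4: "integrable M (\<lambda>\<omega>. (R \<omega> $ j) ^ 4)"
proof (rule Bochner_Integration.integrable_bound)
  show "integrable M (\<lambda>\<omega>. norm (R \<omega>) ^ 4)"
    using psi_norm_finite_imp_integrable[OF _ psi, of 4 4] by simp
  have "norm ((R \<omega> $ j) ^ 4) \<le> norm (norm (R \<omega>) ^ 4)" for \<omega>
    using power_mono[OF component_le_norm_cart[of "R \<omega>" j], of 4] by simp
  then show "AE \<omega> in M. norm ((R \<omega> $ j) ^ 4) \<le> norm (norm (R \<omega>) ^ 4)" by simp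
qed measurable

lemma integrable_regressor_mult_4: "integrable M (\<lambda>\<omega>. (R \<omega> $ i * R \<omega> $ j) ^ 4)"
proof (rule Bochner_Integration.integrable_bound[OF integrable_norm_regressor_8])
  have "\<bar>R \<omega> $ i * R \<omega> $ j\<bar> ^ 4 \<le> (norm (R \<omega>) * norm (R \<omega>)) ^ 4" for \<omega>
    unfolding abs_mult by (intro power_mono mult_mono component_le_norm_cart) auto
  then have "norm ((R \<omega> $ i * R \<omega> $ j) ^ 4) \<le> norm (norm (R \<omega>) ^ 8)" for \<omega>
    by (simp add: power_abs power_mult_distrib flip: power_add)
  then show "AE \<omega> in M. norm ((R \<omega> $ i * R \<omega> $ j) ^ 4) \<le> norm (norm (R \<omega>) ^ 8)" by simp
qed measurable

lemma integrable_regressor_response_4: "integrable M (\<lambda>\<omega>. (R \<omega> $ j * fY \<omega>) ^ 4)"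
proof (rule Bochner_Integration.integrable_bound)
  show "integrable M (\<lambda>\<omega>. norm (R \<omega>) ^ 8 + \<bar>fY \<omega>\<bar> ^ 8)"
    using integrable_norm_regressor_8 integrable_response_8 by simp
  have "norm ((R \<omega> $ j * fY \<omega>) ^ 4) \<le> norm (norm (R \<omega>) ^ 8 + \<bar>fY \<omega>\<bar> ^ 8)" for \<omega>
  proof -
    let ?a = "norm (R \<omega>)" and ?b = "\<bar>fY \<omega>\<bar>"
    have "\<bar>R \<omega> $ j * fY \<omega>\<bar> \<le> max ?a ?b * max ?a ?b"
      unfolding abs_mult using component_le_norm_cart[of "R \<omega>" j] by (intro mult_mono) auto
    then have "\<bar>R \<omega> $ j * fY \<omega>\<bar> ^ 4 \<le> (max ?a ?b * max ?a ?b) ^ 4" by (intro power_mono) auto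
    also have "\<dots> = max ?a ?b ^ 8" by (simp add: power_mult_distrib flip: power_add)
    also have "\<dots> \<le> ?a ^ 8 + ?b ^ 8" by (auto simp: max_def)
    finally show ?thesis by (simp add: power_abs)
  qed
  then show "AE \<omega> in M. norm ((R \<omega> $ j * fY \<omega>) ^ 4) \<le> norm (norm (R \<omega>) ^ 8 + \<bar>fY \<omega>\<bar> ^ 8)" by simp
qed measurable

lemma integrable_regressor: "integrable M (\<lambda>\<omega>. R \<omega> $ j)"
  using integrable_power_le_4[OF _ integrable_regressor_4, of j 1] by simp

lemma integrable_regressor_mult: "integrable M (\<lambda>\<omega>. R \<omega> $ i * R \<omega> $ j)"
  using integrable_power_le_4[OF _ integrable_regressor_mult_4, of i j 1] by simp

lemma integrable_noise: "integrable M \<epsilon>"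
proof -
  have "integrable M (\<lambda>\<omega>. \<epsilon> \<omega> ^ 4)"
    using psi_norm_finite_imp_integrable[of \<epsilon> 2 2 4] model
    by (simp add: linear_model_def sub_gaussian_def)
  from integrable_power_le_4[OF _ this, of 1] show ?thesis by simp
qed

lemma expectation_noise: "expectation \<epsilon> = 0"
  using model by (simp add: linear_model_def)

text \<open>Independence factors the expectation, and the noise is centered. This orthogonality
  removes the noise from the normal equations.\<close>

lemma regressor_noise_uncorrelated:
  "integrable M (\<lambda>\<omega>. R \<omega> $ j * \<epsilon> \<omega>)" "expectation (\<lambda>\<omega>. R \<omega> $ j * \<epsilon> \<omega>) = 0"
proof -
  have nth: "(\<lambda>v :: real ^ 'd. v $ j) \<in> borel_measurable borel"
    using borel_measurable_vec_nth_iff[of "\<lambda>v::real^'d. v" borel] by simp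
  have "indep_rvs M borel R borel \<epsilon>"
    using model by (simp add: linear_model_def)
  from indep_rvs_compose[OF this nth, of "\<lambda>x. x" borel]
  have ind: "indep_var borel (\<lambda>\<omega>. R \<omega> $ j) borel \<epsilon>"
    by (simp add: indep_rvs_iff_indep_var)
  show "integrable M (\<lambda>\<omega>. R \<omega> $ j * \<epsilon> \<omega>)"
    by (rule indep_var_integrable[OF ind integrable_regressor integrable_noise])
  show "expectation (\<lambda>\<omega>. R \<omega> $ j * \<epsilon> \<omega>) = 0"
    using indep_var_lebesgue_integral[OF ind integrable_regressor integrable_noise] expectation_noise
    by simp
qed

lemma expectation_response: "expectation fY = (\<chi> j. expectation (\<lambda>\<omega>. R \<omega> $ j)) \<bullet> \<beta>"
proof -
  have "expectation fY = expectation (\<lambda>\<omega>. (\<Sum>j\<in>UNIV. R \<omega> $ j * \<beta> $ j) + \<epsilon> \<omega>)"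
    using model_AE by (intro integral_cong_AE) (auto simp: inner_vec_def)
  also have "\<dots> = (\<Sum>j\<in>UNIV. expectation (\<lambda>\<omega>. R \<omega> $ j) * \<beta> $ j)"
    using integrable_regressor integrable_noise expectation_noise by simp
  finally show ?thesis by (simp add: inner_vec_def)
qed

text \<open>The normal equations at the population level, obtained by multiplying the model by a
  regressor and taking expectations. With an invertible moment matrix they identify \<beta> as the
  limit of least squares.\<close>

lemma expectation_regressor_response:
  "expectation (\<lambda>\<omega>. R \<omega> $ j * fY \<omega>) = (second_moment_matrix M R *v \<beta>) $ j"
proof -
  have "expectation (\<lambda>\<omega>. R \<omega> $ j * fY \<omega>)
      = expectation (\<lambda>\<omega>. (\<Sum>i\<in>UNIV. R \<omega> $ j * R \<omega> $ i * \<beta> $ i) + R \<omega> $ j * \<epsilon> \<omega>)"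
    using model_AE by (intro integral_cong_AE)
      (auto simp: inner_vec_def sum_distrib_left algebra_simps elim!: eventually_mono)
  also have "\<dots> = (\<Sum>i\<in>UNIV. expectation (\<lambda>\<omega>. R \<omega> $ j * R \<omega> $ i) * \<beta> $ i)"
    using integrable_regressor_mult regressor_noise_uncorrelated by simp
  finally show ?thesis by (simp add: matrix_vector_mult_def second_moment_matrix_def)
qed

end

end

section \<open>The estimator as a function of the joint samples\<close>

text \<open>\<open>regressor\<close> read off from a single joint sample, so that the estimator
  becomes a measurable function of the samples, to which the strong law and independence
  apply.\<close>

definition sample_regressor :: "('s::finite \<Rightarrow> nat) \<Rightarrow> (nat \<Rightarrow> real) \<times> real \<Rightarrow> real ^ ('s option)" where
  "sample_regressor e v = (\<chi> j. case j of None \<Rightarrow> 1 | Some t \<Rightarrow> fst v (e t))"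

text \<open>\<open>joint_vector\<close> is restricted to the indices 1, ..., n, so the enumeration
  has to stay in that range.\<close>

lemma sample_regressor_joint_vector:
  assumes "range e \<subseteq> {1..n}"
  shows "sample_regressor e (joint_vector n X fY \<omega>) = regressor e X \<omega>"
  using assms by (auto simp: image_subset_iff sample_regressor_def joint_vector_def regressor_def vec_eq_iff split: option.split)

lemma sample_regressor_measurable:
  assumes "range e \<subseteq> {1..n}"
  shows "(\<lambda>v. sample_regressor e v $ j) \<in> borel_measurable (joint_space n)"
proof (cases j)
  case (Some t)
  then have "e t \<in> {1..n}" using assms by blast
  then have "(\<lambda>v. fst v (e t)) \<in> borel_measurable (joint_space n)"
    unfolding joint_space_def by (intro measurable_compose[OF measurable_fst] measurable_component_singleton)
  with Some show ?thesis by (simp add: sample_regressor_def)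
qed (simp add: sample_regressor_def)

text \<open>The estimator factors through the exploration samples, so that their independence from
  the exploitation stage passes to it.\<close>

lemma beta_hat_joint_vector:
  assumes "range e \<subseteq> {1..n}"
  shows "beta_hat e Xe fe m \<omega> = least_squares m
    (\<lambda>l. sample_regressor e (joint_vector n (Xe l) (fe l) \<omega>)) (\<lambda>l. snd (joint_vector n (Xe l) (fe l) \<omega>))"
  using sample_regressor_joint_vector[OF assms, of "Xe _" "fe _" \<omega>]
  by (simp add: beta_hat_def) (simp add: joint_vector_def)

lemma joint_vector_measurable:
  assumes "\<And>i. i \<in> {1..n} \<Longrightarrow> X i \<in> borel_measurable M" "fY \<in> borel_measurable M"
  shows "joint_vector n X fY \<in> measurable M (joint_space n)"
  unfolding joint_vector_def joint_space_def using assms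
  by (intro measurable_Pair measurable_restrict) auto

section \<open>Convergence of the LRMC estimator given the coefficient estimates\<close>

theorem corollary4p3:
  fixes M :: "'a measure"
    and n :: nat and S :: "nat set" and e :: "'s::finite \<Rightarrow> nat"
    and X :: "nat \<Rightarrow> 'a \<Rightarrow> real" and fY :: "'a \<Rightarrow> real"
    and c :: "nat \<Rightarrow> real"
    and \<beta> :: "real ^ ('s option)" and \<epsilon> :: "'a \<Rightarrow> real" and \<sigma> K :: real
    and B :: "nat \<Rightarrow> real" and m N :: "nat \<Rightarrow> nat"
    and Xe :: "nat \<Rightarrow> nat \<Rightarrow> 'a \<Rightarrow> real" and fe :: "nat \<Rightarrow> 'a \<Rightarrow> real"
    and T :: "nat \<Rightarrow> nat \<Rightarrow> 'a \<Rightarrow> real ^ ('s option)"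
  assumes M: "prob_space M"
    and S: "S \<noteq> {}" "S \<subseteq> {1..n}" "bij_betw e UNIV S"
    and rv: "\<And>i. i \<in> {1..n} \<Longrightarrow> X i \<in> borel_measurable M" "fY \<in> borel_measurable M"
    and model: "linear_model M (regressor e X) fY \<beta> \<epsilon> \<sigma>"
    and K: "1 \<le> K"
    and moments:
      "max (SUP \<theta>\<in>{\<theta>. norm \<theta> = 1}.
              ennreal (root 4 (prob_space.expectation M (\<lambda>\<omega>. (regressor e X \<omega> \<bullet> \<theta>) ^ 4))))
           (psi_norm M 1 (\<lambda>\<omega>. norm (regressor e X \<omega>))) \<le> ennreal K"
    and Lambda: "invertible (second_moment_matrix M (regressor e X))"
    and B: "filterlim B at_top sequentially"
    and m: "\<And>k. m k > n + 1"
    and N: "\<And>k. N k = exploitation_count n S c (B k) (m k)"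
    and mN: "filterlim (\<lambda>k. min (m k) (N k)) at_top sequentially"
    and explore:
      "iid_copies M (joint_space n) UNIV (\<lambda>l. joint_vector n (Xe l) (fe l)) (joint_vector n X fY)"
    and full_rank: "\<And>k. AE \<omega> in M. full_column_rank (m k) (\<lambda>l. regressor e (Xe l) \<omega>)"
    and exploit: "\<And>k. iid_copies M borel {..<N k} (T k) (regressor e X)"
    and indep: "\<And>k. indep_rvs M
        (\<Pi>\<^sub>M l\<in>UNIV. joint_space n) (\<lambda>\<omega> l. joint_vector n (Xe l) (fe l) \<omega>)
        (\<Pi>\<^sub>M l\<in>{..<N k}. borel) (\<lambda>\<omega>. \<lambda>l\<in>{..<N k}. T k l \<omega>)"
  shows "cond_tendsto_in_prob M
           (sequence_algebra M (\<lambda>k. beta_hat e Xe fe (m k)))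
           (\<lambda>k. lrmc (N k) (T k) (beta_hat e Xe fe (m k)))
           (prob_space.expectation M fY)"
proof -
  interpret prob_space M by (rule M)
  define R where "R = regressor e X"
  define V where "V = (\<lambda>l. joint_vector n (Xe l) (fe l))"
  define bh where "bh = (\<lambda>k. beta_hat e Xe fe (m k))"
  define F where "F = sequence_algebra M bh"
  define \<mu> where "\<mu> = (\<chi> j. expectation (\<lambda>\<omega>. R \<omega> $ j))"
  define Tm where "Tm = (\<lambda>k \<omega>. (1 / real (N k)) *\<^sub>R (\<Sum>l<N k. T k l \<omega>))"
  have e: "range e \<subseteq> {1..n}"
    using S by (auto simp: bij_betw_def)
  have mod: "linear_model M R fY \<beta> \<epsilon> \<sigma>"
    using model by (simp add: R_def)
  \<comment> \<open>The maximum is bounded by the real number \<open>K\<close>, so its second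
    argument is finite.\<close>
  have psi: "psi_norm M 1 (\<lambda>\<omega>. norm (R \<omega>)) < \<infinity>"
    using moments by (auto simp: R_def intro: order.strict_trans1)
  note mo = mod rv(2) psi
  have R: "R \<in> borel_measurable M"
    by (rule model_measurable[OF mo])
  have mk: "filterlim m at_top sequentially" and Nk: "filterlim N at_top sequentially"
    by (rule filterlim_at_top_mono[OF mN], simp)+
  note r = sample_regressor_joint_vector[OF e] and rm = sample_regressor_measurable[OF e]
  have sndm: "snd \<in> borel_measurable (joint_space n)"
    by (simp add: joint_space_def)
  have V0: "joint_vector n X fY \<in> measurable M (joint_space n)"
    by (rule joint_vector_measurable) (use rv in auto)
  have iid: "iid_copies M (joint_space n) UNIV V (joint_vector n X fY)"
    using explore by (simp add: V_def)
  have snd0: "snd (joint_vector n X' f' \<omega>) = f' \<omega>" for X' f' and \<omega> :: 'a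
    by (simp add: joint_vector_def)

  \<comment> \<open>Almost sure convergence of the coefficient estimates\<close>
  have "AE \<omega> in M. (\<lambda>p. (\<Sum>l<p. sample_regressor e (V l \<omega>) $ i * sample_regressor e (V l \<omega>) $ j) / real p)
      \<longlonglongrightarrow> second_moment_matrix M R $ i $ j" for i j
    using strong_law_iid_copies[OF iid V0,
        of "\<lambda>v. sample_regressor e v $ i * sample_regressor e v $ j"]
      integrable_regressor_mult_4[OF mo] rm
    by (simp add: r second_moment_matrix_def R_def)
  \<comment> \<open>The matrix has finitely many entries, so one null set serves them all.\<close>
  then have G: "AE \<omega> in M. \<forall>i j. (\<lambda>p. (\<Sum>l<p. sample_regressor e (V l \<omega>) $ i * sample_regressor e (V l \<omega>) $ j) / real p)
      \<longlonglongrightarrow> second_moment_matrix M R $ i $ j"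
    by (simp add: AE_all_countable)
  have "AE \<omega> in M. (\<lambda>p. (\<Sum>l<p. sample_regressor e (V l \<omega>) $ j * snd (V l \<omega>)) / real p)
      \<longlonglongrightarrow> (second_moment_matrix M R *v \<beta>) $ j" for j
    using strong_law_iid_copies[OF iid V0, of "\<lambda>v. sample_regressor e v $ j * snd v"]
      integrable_regressor_response_4[OF mo] expectation_regressor_response[OF mo] rm sndm
    by (simp add: r snd0 R_def)
  then have v: "AE \<omega> in M. \<forall>j. (\<lambda>p. (\<Sum>l<p. sample_regressor e (V l \<omega>) $ j * snd (V l \<omega>)) / real p)
      \<longlonglongrightarrow> (second_moment_matrix M R *v \<beta>) $ j"
    by (simp add: AE_all_countable)
  have L: "det (second_moment_matrix M R) \<noteq> 0"
    using Lambda by (simp add: R_def invertible_det_nz)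
  have bh_eq: "bh k \<omega> = least_squares (m k) (\<lambda>l. sample_regressor e (V l \<omega>)) (\<lambda>l. snd (V l \<omega>))" for k \<omega>
    by (simp add: bh_def V_def beta_hat_joint_vector[OF e])
  have bh_lim: "AE \<omega> in M. (\<lambda>k. bh k \<omega>) \<longlonglongrightarrow> \<beta>"
    using G v
  proof eventually_elim
    case (elim \<omega>)
    have "(\<lambda>p. least_squares p (\<lambda>l. sample_regressor e (V l \<omega>)) (\<lambda>l. snd (V l \<omega>))) \<longlonglongrightarrow> \<beta>"
      by (rule least_squares_tendsto) (use elim L in auto)
    \<comment> \<open>All budgets use initial segments of one exploration sequence, so the limit in
      the sample size p may be taken along \<open>m k\<close>.\<close>
    from filterlim_compose[OF this mk] show ?case by (simp add: bh_eq)
  qed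

  \<comment> \<open>Independence of the coefficient estimates and the exploitation means\<close>
  define h where "h = (\<lambda>(y :: nat \<Rightarrow> (nat \<Rightarrow> real) \<times> real) k.
    least_squares (m k) (\<lambda>l. sample_regressor e (y l)) (\<lambda>l. snd (y l)))"
  have hm: "h \<in> measurable (\<Pi>\<^sub>M l\<in>UNIV. joint_space n) (\<Pi>\<^sub>M k\<in>UNIV. borel)"
    unfolding h_def
  proof (rule measurable_PiM_single')
    fix k
    have c: "(\<lambda>y. y l) \<in> measurable (\<Pi>\<^sub>M l\<in>UNIV. joint_space n) (joint_space n)" for l :: nat
      by (rule measurable_component_singleton) simp
    show "(\<lambda>y. least_squares (m k) (\<lambda>l. sample_regressor e (y l)) (\<lambda>l. snd (y l)))
        \<in> borel_measurable (\<Pi>\<^sub>M l\<in>UNIV. joint_space n)"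
      by (intro borel_measurable_least_squares measurable_compose[OF c] rm sndm)
  qed (auto simp: PiE_UNIV_domain)
  have hV: "(\<lambda>\<omega>. h (\<lambda>l. V l \<omega>)) = (\<lambda>\<omega> k. bh k \<omega>)"
    by (simp add: h_def bh_eq fun_eq_iff)
  define g where "g = (\<lambda>k (t :: nat \<Rightarrow> real ^ 's option). (1 / real (N k)) *\<^sub>R (\<Sum>l<N k. t l))"
  have gm: "g k \<in> borel_measurable (\<Pi>\<^sub>M l\<in>{..<N k}. borel)" for k
    unfolding g_def
    by (intro borel_measurable_scaleR borel_measurable_const borel_measurable_sum measurable_component_singleton) auto
  have gT: "(\<lambda>\<omega>. g k (\<lambda>l\<in>{..<N k}. T k l \<omega>)) = Tm k" for k
    by (simp add: g_def Tm_def fun_eq_iff)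
  \<comment> \<open>Since \<open>h\<close> produces all estimates at once, \<open>Tm k\<close> is
    independent of the algebra of the whole sequence, not merely of \<open>bh k\<close>.\<close>
  have ind: "indep_rvs M (\<Pi>\<^sub>M k\<in>UNIV. borel) (\<lambda>\<omega> k. bh k \<omega>) borel (Tm k)" for k
    using indep_rvs_compose[OF indep[of k] hm gm[of k]] by (simp add: gT hV[unfolded V_def])

  \<comment> \<open>Measurability and the conditioning algebra\<close>
  have seqm: "(\<lambda>\<omega> k. bh k \<omega>) \<in> measurable M (\<Pi>\<^sub>M k\<in>UNIV. borel)"
    and Tmm [measurable]: "Tm k \<in> borel_measurable M" for k
    using ind by (auto simp: indep_rvs_def)
  have bhm [measurable]: "bh k \<in> borel_measurable M" for k
    using measurable_compose[OF seqm measurable_component_singleton, of k] by simp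
  have sub: "subalgebra M F"
    unfolding F_def sequence_algebra_def subalgebra_def
    using sets_image_in_sets[OF refl seqm] by simp
  have bhF [measurable]: "bh k \<in> borel_measurable F" for k
  proof -
    have "(\<lambda>\<omega> k. bh k \<omega>) \<in> measurable F (\<Pi>\<^sub>M k\<in>UNIV. borel)"
      unfolding F_def sequence_algebra_def by (rule measurable_vimage_algebra1) (auto simp: space_PiM)
    from measurable_compose[OF this measurable_component_singleton, of k] show ?thesis by simp
  qed
  have spF: "space F = space M" using sub by (simp add: subalgebra_def)
  \<comment> \<open>Linearity of the inner product separates the exploitation mean from the
    estimate; for \<open>N k = 0\<close> both sides are 0.\<close>
  have W: "lrmc (N k) (T k) (bh k) \<omega> = Tm k \<omega> \<bullet> bh k \<omega>" for k \<omega>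
    by (simp add: lrmc_def Tm_def inner_sum_left)
  have Wm [measurable]: "lrmc (N k) (T k) (bh k) \<in> borel_measurable M" for k
    unfolding W by measurable
  have Ef: "expectation fY = \<mu> \<bullet> \<beta>"
    using expectation_response[OF mo] by (simp add: \<mu>_def)

  \<comment> \<open>Conditional deviation probabilities\<close>
  have key: "AE \<omega> in M. (\<lambda>k. real_cond_exp M F
      (indicator {\<omega>' \<in> space M. \<bar>lrmc (N k) (T k) (bh k) \<omega>' - expectation fY\<bar> > \<delta>}) \<omega>) \<longlonglongrightarrow> 0"
    if "0 < \<delta>" for \<delta>
  proof -
    define A where "A = (\<lambda>k. {\<omega> \<in> space M. \<bar>lrmc (N k) (T k) (bh k) \<omega> - expectation fY\<bar> > \<delta>})"
    \<comment> \<open>When both deviations are at most \<eta>, the error is at most \<eta>^2 +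
      \<eta> |\<beta>| + \<eta> |\<mu>|. The cap 1 replaces \<eta>^2 by \<eta>, and the quotient
      makes the total at most \<delta>.\<close>
    define \<eta> where "\<eta> = min 1 (\<delta> / (1 + norm \<beta> + norm \<mu>))"
    have s: "0 < 1 + norm \<beta> + norm \<mu>"
      using norm_ge_zero[of \<beta>] norm_ge_zero[of \<mu>] by linarith
    have \<eta>: "0 < \<eta>" "\<eta> \<le> 1" using \<open>0 < \<delta>\<close> s by (auto simp: \<eta>_def)
    have \<eta>\<delta>: "\<eta> * (1 + norm \<beta> + norm \<mu>) \<le> \<delta>"
      using s by (simp add: \<eta>_def pos_le_divide_eq[symmetric])
    define G where "G = (\<lambda>k. {\<omega> \<in> space M. \<eta> < norm (bh k \<omega> - \<beta>)})"
    define D where "D = (\<lambda>k. {\<omega> \<in> space M. \<eta> < norm (Tm k \<omega> - \<mu>)})"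
    have AGD: "A k \<subseteq> G k \<union> D k" for k
    proof
      fix \<omega> assume \<omega>: "\<omega> \<in> A k"
      show "\<omega> \<in> G k \<union> D k"
      proof (rule ccontr)
        assume "\<omega> \<notin> G k \<union> D k"
        with \<omega> have b: "norm (bh k \<omega> - \<beta>) \<le> \<eta>" and t: "norm (Tm k \<omega> - \<mu>) \<le> \<eta>"
          by (auto simp: A_def G_def D_def)
        have "Tm k \<omega> \<bullet> bh k \<omega> - \<mu> \<bullet> \<beta>
            = (Tm k \<omega> - \<mu>) \<bullet> (bh k \<omega> - \<beta>) + (Tm k \<omega> - \<mu>) \<bullet> \<beta> + \<mu> \<bullet> (bh k \<omega> - \<beta>)"
          by (simp add: inner_diff_left inner_diff_right)
        also have "\<bar>\<dots>\<bar> \<le> norm (Tm k \<omega> - \<mu>) * norm (bh k \<omega> - \<beta>)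
            + norm (Tm k \<omega> - \<mu>) * norm \<beta> + norm \<mu> * norm (bh k \<omega> - \<beta>)"
          by (intro order_trans[OF abs_triangle_ineq] add_mono Cauchy_Schwarz_ineq2)
        also have "\<dots> \<le> \<eta> * 1 + \<eta> * norm \<beta> + norm \<mu> * \<eta>"
          using b t \<eta> by (intro add_mono mult_mono) auto
        also have "\<dots> \<le> \<delta>" using \<eta>\<delta> by (simp add: algebra_simps)
        finally show False using \<omega> by (simp add: A_def W Ef)
      qed
    qed
    have GF: "G k \<in> sets F" for k
      unfolding G_def spF[symmetric] by measurable
    have Dm: "D k \<in> events" and Am: "A k \<in> events" for k
      unfolding D_def A_def by measurable
    \<comment> \<open>\<open>D k\<close> is an event about \<open>Tm k\<close> alone, and
      \<open>ind\<close> makes \<open>Tm k\<close> independent of \<open>F\<close>.\<close>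
    have indD: "prob (E \<inter> D k) = prob E * prob (D k)" if "E \<in> sets F" for E k
    proof (rule indep_setD)
      show "indep_set (sets F) (sets (vimage_algebra (space M) (Tm k) borel))"
        using ind[of k] by (simp add: indep_rvs_def F_def sequence_algebra_def)
      have "{v. \<eta> < norm (v - \<mu>)} \<in> sets borel" by measurable
      from in_vimage_algebra[OF this, of "Tm k" "space M"]
      show "D k \<in> sets (vimage_algebra (space M) (Tm k) borel)"
        by (simp add: D_def vimage_def Int_def conj_commute)
    qed (rule that)
    \<comment> \<open>There are countably many budgets, so the exceptional null sets can be
      united.\<close>
    have bounds_AE: "AE \<omega> in M. \<forall>k. 0 \<le> real_cond_exp M F (indicator (A k)) \<omega>
        \<and> real_cond_exp M F (indicator (A k)) \<omega> \<le> indicator (G k) \<omega> + prob (D k)"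
      using real_cond_exp_indicator_bounds[OF sub Am GF Dm AGD indD] by (simp add: AE_all_countable)
    have D0: "(\<lambda>k. prob (D k)) \<longlonglongrightarrow> 0"
      unfolding D_def Tm_def \<mu>_def
      by (rule iid_copies_vec_mean_deviation_tendsto[OF _ R integrable_regressor_4[OF mo] Nk \<eta>(1)])
        (use exploit in \<open>simp add: R_def\<close>)
    show ?thesis
      using bounds_AE bh_lim
    proof eventually_elim
      case (elim \<omega>)
      note bounds = elim(1)
      \<comment> \<open>On a path where the estimates converge, \<open>G k\<close> fails from some
        \<open>k\<close> on that may depend on \<omega>, and its indicator drops out of the
        bound.\<close>
      have "\<forall>\<^sub>F k in sequentially. dist (bh k \<omega>) \<beta> < \<eta>"
        using elim(2) \<eta>(1) by (rule tendstoD)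
      then have le: "\<forall>\<^sub>F k in sequentially. real_cond_exp M F (indicator (A k)) \<omega> \<le> prob (D k)"
      proof eventually_elim
        case (elim k)
        then have "\<omega> \<notin> G k" by (simp add: G_def dist_norm)
        then show ?case
          using bounds[rule_format, of k] by simp
      qed
      have "(\<lambda>k. real_cond_exp M F (indicator (A k)) \<omega>) \<longlonglongrightarrow> 0"
        by (rule tendsto_sandwich[OF _ le tendsto_const D0]) (use bounds in auto)
      then show ?case by (simp add: A_def)
    qed
  qed
  \<comment> \<open>The null set from \<open>key\<close> depends on \<delta>; countability of the
    positive rationals yields a common one.\<close>
  have "AE \<omega> in M. \<forall>\<delta>\<in>\<rat> \<inter> {0<..}. (\<lambda>k. real_cond_exp M F
      (indicator {\<omega>' \<in> space M. \<bar>lrmc (N k) (T k) (bh k) \<omega>' - expectation fY\<bar> > \<delta>}) \<omega>) \<longlonglongrightarrow> 0"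
    using key by (subst AE_ball_countable) (auto intro: countable_rat countable_Int1)
  then have "cond_tendsto_in_prob M F (\<lambda>k. lrmc (N k) (T k) (bh k)) (expectation fY)"
    unfolding cond_tendsto_in_prob_def using sub Wm by auto
  then show ?thesis
    by (simp add: F_def bh_def)
qed

end
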